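(* For any $\theta>0$, there exists a constant $c$ that depends only on $\theta$ such that for all $t\ge4$ and all positive functions $f$ on $\mathbb{N}$ satisfying $\Delta\log f(n)\ge0$ for all $n\ge1$, we have $$\pi_\theta\Bigl(\Bigl\{f\ge t\int f\,d\pi_\theta\Bigr\}\Bigr)\le c\,\frac{\sqrt{\log\log t}}{t\sqrt{\log t}}.$$
   Context: $\mathbb{N}=\{0,1,2,\dots\}$. For $g\colon\mathbb{N}\to\mathbb{R}$ and $n\ge1$, $\Delta g(n):=g(n+1)+g(n-1)-2g(n)$. $\pi_\theta$ is the Poisson probability measure on $\mathbb{N}$: $\pi_\theta(k)=e^{-\theta}\theta^k/k!$. If $\int f\,d\pi_\theta=+\infty$ the set on the left is empty. *)

theory Defs
  imports "HOL-Probability.Probability_Mass_Function"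
begin

definition discrete_laplacian :: "(nat \<Rightarrow> real) \<Rightarrow> nat \<Rightarrow> real"
  where "discrete_laplacian g n = g (n + 1) + g (n - 1) - 2 * g n"
  \<comment> \<open>Only meaningful for \<open>n \<ge> 1\<close>, because of truncated subtraction.\<close>

end

theory Submission
  imports Defs
begin

text \<open>
  Write \<open>I\<close> for the integral of \<open>f\<close> and \<open>b\<close> for the least element of the level set
  \<open>{f \<ge> t I}\<close>. Only the weak consequence is needed that the level set lies in \<open>{b..}\<close>, so that
  its measure is at most the Poisson tail at \<open>b\<close>, which \<open>poisson_tail_le\<close> bounds by
  \<open>\<theta>\<^sup>b / b!\<close>.

  A log-convex \<open>f\<close> lies above the geometric sequence \<open>f b q\<^sup>k\<^sup>-\<^sup>b\<close> with \<open>q = f (b + 1) / f b\<close>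
  (\<open>log_convex_geometric_lower_bound\<close>), whose Poisson integral is
  \<open>f b q\<^sup>-\<^sup>b exp (\<theta> (q - 1))\<close>. Since \<open>f b \<ge> t I\<close>, this gives \<open>t \<le> q\<^sup>b exp (- \<theta> (q - 1))\<close>, and
  maximising over \<open>q\<close> gives \<open>t \<le> exp \<theta> (b / (\<theta> e))\<^sup>b\<close> (\<open>log_convex_level_bound\<close>). The right-hand
  side is the quantity that Stirling's lower bound for \<open>b!\<close> (\<open>fact_ge_stirling\<close>) puts into the
  tail estimate: the measure of the level set is at most \<open>exp \<theta> / (t sqrt b)\<close>. Taking logarithms of
  the same inequality shows \<open>ln t \<le> b (D + ln b)\<close> for some \<open>D\<close> depending on \<open>\<theta>\<close>, hence \<open>b\<close> is at
  least a constant times \<open>ln t / ln (ln t)\<close>, which is the claim.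

  The argument needs \<open>b \<noteq> 0\<close>. If \<open>b = 0\<close>, the inequality reads \<open>t \<le> exp \<theta>\<close>; for such \<open>t\<close> the
  asserted bound is bounded away from \<open>0\<close> and a large constant suffices.
\<close>

section \<open>Log-convex sequences\<close>

text \<open>
  The supporting line at \<open>m\<close> of the convex sequence \<open>ln f\<close>, with the negative powers of the slope
  cleared. The hypothesis is log-convexity in multiplicative form.
\<close>

lemma log_convex_geometric_lower_bound:
  fixes f :: "nat \<Rightarrow> real"
  assumes pos: "\<And>n. f n > 0"
    and cvx: "\<And>n. (f (Suc n))\<^sup>2 \<le> f n * f (Suc (Suc n))"
  defines "q \<equiv> \<lambda>n. f (Suc n) / f n"
  shows "f m * q m ^ k \<le> f k * q m ^ m"
proof -
  have qpos: "q n > 0" for n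
    using pos by (simp add: q_def)
  have step: "f (Suc n) = f n * q n" for n
    using pos[of n] by (simp add: q_def)
  have "q n \<le> q (Suc n)" for n
    using cvx[of n] pos[of n] pos[of "Suc n"]
    by (simp add: q_def field_simps power2_eq_square)
  then have q_mono: "i \<le> j \<Longrightarrow> q i \<le> q j" for i j
    by (rule lift_Suc_mono_le)
  show ?thesis
  proof (cases "m \<le> k")
    case True
    then show ?thesis
    proof (induction k rule: dec_induct)
      case (step k)
      have "f m * q m ^ Suc k \<le> (f k * q m ^ m) * q m"
        using step.IH qpos[of m] by (simp add: mult.assoc[symmetric] mult.commute[of "q m"] mult_right_mono)
      also have "\<dots> \<le> (f k * q m ^ m) * q k"
        using q_mono[OF step.hyps(1)] pos[of k] qpos[of m]
        by (intro mult_left_mono) (auto simp: less_imp_le)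
      also have "\<dots> = f (Suc k) * q m ^ m"
        by (simp add: \<open>f (Suc k) = f k * q k\<close>)
      finally show ?case .
    qed simp
  next
    case False
    then have "k \<le> m" by simp
    then show ?thesis
    proof (induction k rule: inc_induct)
      case (step k)
      have "(f m * q m ^ k) * q m = f m * q m ^ Suc k"
        by simp
      also have "\<dots> \<le> f (Suc k) * q m ^ m"
        by (rule step.IH)
      also have "\<dots> = (f k * q m ^ m) * q k"
        by (simp add: \<open>f (Suc k) = f k * q k\<close>)
      also have "\<dots> \<le> (f k * q m ^ m) * q m"
        using q_mono[of k m] step.hyps pos[of k] qpos[of m]
        by (intro mult_left_mono) (auto simp: less_imp_le)
      finally show ?case
        using qpos[of m] by simp
    qed simp
  qed
qed

section \<open>The Poisson distribution\<close>

text \<open>The probability generating function.\<close>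

lemma nn_integral_poisson_power:
  fixes \<theta> r :: real
  assumes "\<theta> > 0" "r \<ge> 0"
  shows "(\<integral>\<^sup>+k. ennreal (r ^ k) \<partial>measure_pmf (poisson_pmf \<theta>)) = ennreal (exp (\<theta> * (r - 1)))"
proof -
  have "(\<lambda>k. exp (-\<theta>) * ((r * \<theta>) ^ k /\<^sub>R fact k)) sums (exp (-\<theta>) * exp (r * \<theta>))"
    by (intro sums_mult exp_converges)
  moreover have "exp (-\<theta>) * exp (r * \<theta>) = exp (\<theta> * (r - 1))"
    by (simp add: exp_add[symmetric] algebra_simps)
  moreover have "exp (-\<theta>) * ((r * \<theta>) ^ k /\<^sub>R fact k) = pmf (poisson_pmf \<theta>) k * r ^ k" for k
    using assms by (simp add: power_mult_distrib field_simps)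
  ultimately have sums: "(\<lambda>k. pmf (poisson_pmf \<theta>) k * r ^ k) sums exp (\<theta> * (r - 1))"
    by simp
  have "(\<integral>\<^sup>+k. ennreal (r ^ k) \<partial>measure_pmf (poisson_pmf \<theta>))
      = (\<Sum>k. ennreal (pmf (poisson_pmf \<theta>) k * r ^ k))"
    using assms
    by (simp add: nn_integral_measure_pmf nn_integral_count_space_nat ennreal_mult del: pmf_poisson)
  also have "\<dots> = ennreal (exp (\<theta> * (r - 1)))"
    using sums assms by (intro suminf_ennreal_eq) auto
  finally show ?thesis .
qed

text \<open>
  By \<open>b! j! \<le> (b + j)!\<close>, the tail from \<open>b\<close> on is dominated termwise by \<open>\<theta>\<^sup>b / b!\<close> times the whole
  distribution.
\<close>

lemma poisson_tail_le:
  fixes \<theta> :: real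
  assumes "\<theta> > 0"
  shows "measure (measure_pmf (poisson_pmf \<theta>)) {b..} \<le> \<theta> ^ b / fact b"
proof -
  let ?P = "measure_pmf (poisson_pmf \<theta>)"
  have sums: "(\<lambda>j. pmf (poisson_pmf \<theta>) (b + j)) sums measure ?P {b..}" for b
  proof -
    have "(\<lambda>j. measure ?P {b + j}) sums measure ?P (\<Union>j. {b + j})"
      by (intro measure_pmf.finite_measure_UNION) (auto simp: disjoint_family_on_def)
    moreover have "(\<Union>j. {b + j}) = {b..}"
      by (auto simp: le_iff_add)
    ultimately show ?thesis
      by (simp add: measure_pmf_single)
  qed
  have "(\<lambda>j. pmf (poisson_pmf \<theta>) j) sums 1"
    using sums[of 0] by (simp add: atLeast_0 del: pmf_poisson)
  then have "(\<lambda>j. \<theta> ^ b / fact b * pmf (poisson_pmf \<theta>) j) sums (\<theta> ^ b / fact b * 1)"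
    by (rule sums_mult)
  moreover have "pmf (poisson_pmf \<theta>) (b + j) \<le> \<theta> ^ b / fact b * pmf (poisson_pmf \<theta>) j" for j
  proof -
    have "fact b * fact j dvd (fact (b + j) :: nat)"
      using fact_fact_dvd_fact[of b j] by simp
    then have "fact b * fact j \<le> (fact (b + j) :: nat)"
      by (rule dvd_imp_le) simp
    then have "real (fact b * fact j) \<le> real (fact (b + j))"
      by (simp only: of_nat_le_iff)
    then have "\<theta> ^ (b + j) / fact (b + j) \<le> \<theta> ^ (b + j) / (fact b * fact j)"
      using assms by (intro divide_left_mono) auto
    then have "\<theta> ^ (b + j) / fact (b + j) * exp (-\<theta>) \<le> \<theta> ^ (b + j) / (fact b * fact j) * exp (-\<theta>)"
      by (rule mult_right_mono) simp
    then show ?thesis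
      using assms by (simp add: power_add)
  qed
  ultimately show ?thesis
    using sums_le[OF _ sums[of b]] by (metis mult.right_neutral)
qed

section \<open>A lower bound of Stirling type\<close>

lemma ln_add_one_le_cubic:
  fixes y :: real
  assumes "y \<ge> 0"
  shows "ln (1 + y) \<le> y - y\<^sup>2 / 2 + y ^ 3 / 3"
proof -
  let ?h = "\<lambda>y::real. y - y\<^sup>2 / 2 + y ^ 3 / 3 - ln (1 + y)"
  have "?h 0 \<le> ?h y"
  proof (rule DERIV_nonneg_imp_nondecreasing[OF assms])
    fix x :: real
    assume "0 \<le> x" "x \<le> y"
    then have "(?h has_real_derivative (1 - x + x\<^sup>2 - 1 / (1 + x))) (at x)"
      by (auto intro!: derivative_eq_intros simp: power2_eq_square)
    moreover have "1 - x + x\<^sup>2 - 1 / (1 + x) = x ^ 3 / (1 + x)"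
      using \<open>0 \<le> x\<close> by (simp add: field_simps power2_eq_square power3_eq_cube)
    ultimately show "\<exists>d. (?h has_real_derivative d) (at x) \<and> d \<ge> 0"
      using \<open>0 \<le> x\<close> by fastforce
  qed
  then show ?thesis by simp
qed

text \<open>
  Stirling's formula with a worse constant. The shift from \<open>sqrt n\<close> to \<open>sqrt (n + 1)\<close> makes the
  quotient of the two sides increasing, so that induction applies: with \<open>sqrt n\<close> the quotient
  decreases to its limit.
\<close>

lemma fact_ge_stirling:
  "sqrt (real n + 1) * (real n / exp 1) ^ n \<le> fact n"
proof -
  \<comment> \<open>The induction step reduces to \<open>n \<ge> 2\<close>, so the cases \<open>0\<close> and \<open>1\<close> are treated separately.\<close>
  have ln_form: "ln (real n + 1) / 2 + real n * ln (real n) - real n \<le> ln (fact n)" if "n \<ge> 2" for n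
    using that
  proof (induction n rule: dec_induct)
    case base
    have "sqrt 3 * 2 \<le> exp (2::real)"
    proof -
      have "sqrt 3 \<le> (2::real)" by (rule real_le_lsqrt) auto
      moreover have "(2::real) * 2 \<le> exp 1 * exp 1"
        using exp_ge_add_one_self[of "1::real"] by (intro mult_mono) auto
      ultimately show ?thesis by (simp add: exp_add[symmetric])
    qed
    then have "ln (sqrt 3 * 2) \<le> ln (exp (2::real))"
      by (subst ln_le_cancel_iff) auto
    then show ?case
      by (simp add: ln_mult ln_sqrt)
  next
    case (step n)
    define x where "x = real n"
    have x: "x \<ge> 2" using step.hyps by (simp add: x_def)
    have l1: "ln (x + 1) = ln x + ln (1 + 1 / x)"
    proof -
      have "x + 1 = x * (1 + 1 / x)"
        using x by (simp add: field_simps)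
      moreover have "x > 0" "1 + 1 / x > 0"
        using x by (auto intro: add_pos_pos)
      ultimately show ?thesis
        by (simp only: ln_mult_pos)
    qed
    have l2: "ln (x + 2) = ln (x + 1) + ln (1 + 1 / (x + 1))"
    proof -
      have "x + 2 = (x + 1) * (1 + 1 / (x + 1))"
        using x by (simp add: field_simps)
      moreover have "x + 1 > 0" "1 + 1 / (x + 1) > 0"
        using x by (auto intro: add_pos_pos)
      ultimately show ?thesis
        by (simp only: ln_mult_pos)
    qed
    have "x * ln (1 + 1 / x) \<le> x * (1 / x - (1 / x)\<^sup>2 / 2 + (1 / x) ^ 3 / 3)"
      using ln_add_one_le_cubic[of "1 / x"] x by (intro mult_left_mono) auto
    also have "\<dots> = 1 - 1 / (2 * x) + 1 / (3 * x\<^sup>2)"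
      using x by (simp add: field_simps power2_eq_square power3_eq_cube)
    finally have a: "x * ln (1 + 1 / x) \<le> 1 - 1 / (2 * x) + 1 / (3 * x\<^sup>2)" .
    have b: "ln (1 + 1 / (x + 1)) / 2 \<le> 1 / (x + 1) / 2"
      using x by (intro divide_right_mono ln_add_one_self_le_self) auto
    have "1 / (2 * x) - 1 / (3 * x\<^sup>2) - 1 / (x + 1) / 2 = (x - 2) / (6 * x\<^sup>2 * (x + 1))"
      using x by (simp add: divide_simps) (simp add: algebra_simps power2_eq_square)
    also have "\<dots> \<ge> 0"
      using x by simp
    finally have c: "1 / (x + 1) / 2 \<le> 1 / (2 * x) - 1 / (3 * x\<^sup>2)"
      by simp
    have "ln (x + 2) / 2 + (x + 1) * ln (x + 1) - (x + 1)
        = (ln (x + 1) / 2 + x * ln x - x) + ln (x + 1)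
          + (x * ln (1 + 1 / x) + ln (1 + 1 / (x + 1)) / 2 - 1)"
    proof -
      have "x * ln (x + 1) = x * ln x + x * ln (1 + 1 / x)"
        by (simp add: l1 distrib_left)
      then show ?thesis
        by (simp add: l2 add_divide_distrib distrib_right)
    qed
    also have "\<dots> \<le> ln (fact n) + ln (x + 1) + 0"
    proof (intro add_mono)
      show "x * ln (1 + 1 / x) + ln (1 + 1 / (x + 1)) / 2 - 1 \<le> 0"
        using a order_trans[OF b c] by linarith
    qed (use step.IH in \<open>simp_all add: x_def\<close>)
    also have "\<dots> = ln (fact (Suc n))"
      using x by (simp add: x_def ln_mult_pos add.commute)
    finally show ?case
      by (simp add: x_def algebra_simps)
  qed
  consider "n = 0" | "n = 1" | "n \<ge> 2" by linarith
  then show ?thesis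
  proof cases
    case 2
    have "sqrt 2 \<le> (2::real)" by (rule real_le_lsqrt) auto
    also have "2 \<le> exp (1::real)" using exp_ge_add_one_self[of "1::real"] by simp
    finally show ?thesis using 2 by simp
  next
    case 3
    have "ln (sqrt (real n + 1) * (real n / exp 1) ^ n)
        = ln (real n + 1) / 2 + real n * ln (real n) - real n"
      using 3 by (simp add: ln_mult_pos ln_realpow ln_div ln_sqrt algebra_simps)
    also have "\<dots> \<le> ln (fact n)"
      using ln_form[OF 3] .
    finally show ?thesis
      using 3 by (subst (asm) ln_le_cancel_iff) auto
  qed simp
qed

section \<open>Level sets of log-convex functions\<close>

text \<open>The maximum of the left-hand side over \<open>r\<close> is attained at \<open>r = b / \<theta>\<close>.\<close>

lemma power_mult_exp_le:
  fixes \<theta> r :: real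
  assumes "\<theta> > 0" "r \<ge> 0"
  shows "r ^ b * exp (-(\<theta> * r)) \<le> (real b / (\<theta> * exp 1)) ^ b"
proof (cases "b = 0")
  case False
  define x where "x = \<theta> * r / real b"
  have "x \<le> exp (x - 1)"
    using exp_ge_add_one_self[of "x - 1"] by simp
  moreover have "x \<ge> 0"
    using assms by (simp add: x_def)
  ultimately have "x ^ b \<le> exp (x - 1) ^ b"
    by (intro power_mono)
  also have "\<dots> = exp (\<theta> * r) / exp 1 ^ b"
    using False by (simp add: exp_of_nat_mult[symmetric] exp_diff[symmetric] x_def algebra_simps)
  finally have "x ^ b * (exp 1 ^ b * exp (-(\<theta> * r))) \<le> 1"
    by (simp add: exp_minus field_simps)
  moreover have "r ^ b * exp (-(\<theta> * r))
      = (x ^ b * (exp 1 ^ b * exp (-(\<theta> * r)))) * (real b / (\<theta> * exp 1)) ^ b"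
    using assms False by (simp add: x_def power_mult_distrib power_divide)
  ultimately show ?thesis
    using assms by (metis mult_left_le_one_le mult_nonneg_nonneg divide_nonneg_nonneg exp_ge_zero
        less_imp_le of_nat_0_le_iff zero_le_power \<open>x \<ge> 0\<close>)
qed (use assms in simp)

text \<open>
  If \<open>f\<close> is not integrable, the last assumption fails for \<open>t > 0\<close>, while for \<open>t = 0\<close> the conclusion
  is trivial; so no integrability assumption is needed.
\<close>

lemma log_convex_level_bound:
  fixes \<theta> t :: real and f :: "nat \<Rightarrow> real"
  assumes \<theta>: "\<theta> > 0" and t: "t \<ge> 0"
    and pos: "\<And>n. f n > 0"
    and cvx: "\<And>n. (f (Suc n))\<^sup>2 \<le> f n * f (Suc (Suc n))"
    and b: "ennreal t * (\<integral>\<^sup>+k. ennreal (f k) \<partial>measure_pmf (poisson_pmf \<theta>)) \<le> ennreal (f b)"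
  shows "t \<le> exp \<theta> * (real b / (\<theta> * exp 1)) ^ b"
proof -
  define q where "q = f (Suc b) / f b"
  have q: "q > 0" using pos by (simp add: q_def)
  have "f b / q ^ b * q ^ k \<le> f k" for k
    using log_convex_geometric_lower_bound[of f b k, OF pos cvx] q
    by (simp add: q_def[symmetric] field_simps)
  then have "ennreal (f b / q ^ b) * ennreal (q ^ k) \<le> ennreal (f k)" for k
    using q pos[of b] by (subst ennreal_mult[symmetric]) (auto simp: ennreal_leI)
  then have "(\<integral>\<^sup>+k. ennreal (f b / q ^ b) * ennreal (q ^ k) \<partial>measure_pmf (poisson_pmf \<theta>))
      \<le> (\<integral>\<^sup>+k. ennreal (f k) \<partial>measure_pmf (poisson_pmf \<theta>))"
    by (intro nn_integral_mono)
  then have "ennreal (f b / q ^ b) * ennreal (exp (\<theta> * (q - 1)))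
      \<le> (\<integral>\<^sup>+k. ennreal (f k) \<partial>measure_pmf (poisson_pmf \<theta>))"
    using \<theta> q by (simp add: nn_integral_cmult nn_integral_poisson_power)
  then have "ennreal t * (ennreal (f b / q ^ b) * ennreal (exp (\<theta> * (q - 1)))) \<le> ennreal (f b)"
    using b by (meson mult_left_mono order_trans zero_le)
  then have "ennreal (t * (f b / q ^ b * exp (\<theta> * (q - 1)))) \<le> ennreal (f b)"
    using t q pos[of b] by (simp add: ennreal_mult del: times_divide_eq_left times_divide_eq_right)
  then have "t * (f b / q ^ b * exp (\<theta> * (q - 1))) \<le> f b"
    using pos[of b] by (simp add: ennreal_le_iff)
  then have "t \<le> q ^ b * exp (-(\<theta> * (q - 1)))"
  proof -
    have "exp (-(\<theta> * (q - 1))) = 1 / exp (\<theta> * (q - 1))"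
      by (simp add: exp_minus inverse_eq_divide)
    moreover have "t * exp (\<theta> * (q - 1)) \<le> q ^ b"
      using \<open>t * (f b / q ^ b * exp (\<theta> * (q - 1))) \<le> f b\<close> pos[of b] q
      by (simp add: field_simps)
    ultimately show ?thesis
      by (simp add: pos_le_divide_eq)
  qed
  also have "\<dots> = exp \<theta> * (q ^ b * exp (-(\<theta> * q)))"
    by (simp add: algebra_simps exp_add[symmetric])
  also have "\<dots> \<le> exp \<theta> * (real b / (\<theta> * exp 1)) ^ b"
    using power_mult_exp_le[OF \<theta>, of q b] q by simp
  finally show ?thesis .
qed

text \<open>This makes \<open>ln (ln t)\<close> bounded away from \<open>0\<close> for \<open>t \<ge> 4\<close>.\<close>

lemma ln_four_gt_one: "ln 4 > (1::real)"
proof -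
  have "ln (exp 1) < ln (4::real)"
    using exp_le by (subst ln_less_cancel_iff) auto
  then show ?thesis by simp
qed

theorem proposition3p8:
  fixes \<theta> :: real
  assumes "\<theta> > 0"
  shows "\<exists>c :: real. \<forall>t :: real. \<forall>f :: nat \<Rightarrow> real.
           t \<ge> 4 \<longrightarrow> (\<forall>n. f n > 0) \<longrightarrow>
           (\<forall>n\<ge>1. discrete_laplacian (\<lambda>k. ln (f k)) n \<ge> 0) \<longrightarrow>
           measure (measure_pmf (poisson_pmf \<theta>))
             {n. ennreal (f n) \<ge> ennreal t * (\<integral>\<^sup>+k. ennreal (f k) \<partial>measure_pmf (poisson_pmf \<theta>))}
           \<le> c * (sqrt (ln (ln t)) / (t * sqrt (ln t)))"
proof -
  define l where "l = ln (ln (4::real))"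
  have l: "l > 0" using ln_four_gt_one by (simp add: l_def)
  define D where "D = \<theta> + \<bar>ln (\<theta> * exp 1)\<bar>"
  have D: "D \<ge> 0" using assms by (simp add: D_def)
  define K where "K = (D + 1) / l + 1"
  have K: "K \<ge> 0" using D l by (simp add: K_def)
  \<comment> \<open>\<open>c1\<close> serves the range \<open>t \<le> exp \<theta>\<close>, and \<open>c2\<close> the remaining \<open>t\<close>.\<close>
  define c1 where "c1 = exp \<theta> * sqrt \<theta> / sqrt l"
  define c2 where "c2 = exp \<theta> * sqrt K"
  have c: "c1 \<ge> 0" "c2 \<ge> 0"
    using l K assms by (auto simp: c1_def c2_def)
  show ?thesis
  proof (intro exI[of _ "c1 + c2"] allI impI)
    fix t :: real and f :: "nat \<Rightarrow> real"
    assume t: "t \<ge> 4" and f: "\<forall>n. f n > 0"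
      and lap: "\<forall>n\<ge>1. discrete_laplacian (\<lambda>k. ln (f k)) n \<ge> 0"
    let ?P = "measure_pmf (poisson_pmf \<theta>)"
    let ?A = "{n. ennreal (f n) \<ge> ennreal t * (\<integral>\<^sup>+k. ennreal (f k) \<partial>?P)}"
    let ?B = "sqrt (ln (ln t)) / (t * sqrt (ln t))"
    have ln4: "ln 4 > (1::real)"
      by (rule ln_four_gt_one)
    have "ln 4 \<le> ln t" using t by simp
    with ln4 have lnt: "ln t > 1" by simp
    have lt: "l \<le> ln (ln t)"
      unfolding l_def using \<open>ln 4 \<le> ln t\<close> ln4 by simp
    have B: "?B \<ge> 0" using t lnt lt l by simp
    have cvx: "(f (Suc n))\<^sup>2 \<le> f n * f (Suc (Suc n))" for n
    proof -
      have "2 * ln (f (Suc n)) \<le> ln (f n) + ln (f (Suc (Suc n)))"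
        using lap[rule_format, of "Suc n"] by (simp add: discrete_laplacian_def)
      moreover have "ln ((f (Suc n))\<^sup>2) = 2 * ln (f (Suc n))"
        using f[rule_format, of "Suc n"] by (simp add: ln_realpow)
      moreover have "ln (f n * f (Suc (Suc n))) = ln (f n) + ln (f (Suc (Suc n)))"
        using f[rule_format, of n] f[rule_format, of "Suc (Suc n)"] by (simp add: ln_mult_pos)
      ultimately have "ln ((f (Suc n))\<^sup>2) \<le> ln (f n * f (Suc (Suc n)))"
        by simp
      then show ?thesis
        using f[rule_format, of n] f[rule_format, of "Suc n"] f[rule_format, of "Suc (Suc n)"]
        by (subst (asm) ln_le_cancel_iff) auto
    qed
    have level: "t \<le> exp \<theta> * (real n / (\<theta> * exp 1)) ^ n" if "n \<in> ?A" for n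
      using that t f cvx by (intro log_convex_level_bound[where f = f] assms) auto
    consider "?A = {}" | "t \<le> exp \<theta>" | "?A \<noteq> {}" "t > exp \<theta>" by fastforce
    then show "measure ?P ?A \<le> (c1 + c2) * ?B"
    proof cases
      case 1
      have "0 \<le> (c1 + c2) * ?B"
        using B c by (intro mult_nonneg_nonneg) auto
      then show ?thesis by (simp only: 1 measure_empty)
    next
      case 2
      then have "ln t \<le> ln (exp \<theta>)" using t by (subst ln_le_cancel_iff) auto
      then have "t * sqrt (ln t) \<le> exp \<theta> * sqrt \<theta>"
        using 2 t lnt by (intro mult_mono) auto
      moreover have "sqrt l \<le> sqrt (ln (ln t))" using lt by simp
      ultimately have "1 / c1 \<le> ?B"
        unfolding c1_def using l lnt t by (simp add: frac_le)
      moreover have "c1 > 0"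
        using l assms by (simp add: c1_def)
      ultimately have "1 \<le> c1 * ?B"
        by (simp only: pos_divide_le_eq mult.commute)
      also have "\<dots> \<le> (c1 + c2) * ?B"
        using B c by (intro mult_right_mono) auto
      finally show ?thesis
        using measure_pmf.prob_le_1[of "poisson_pmf \<theta>" ?A] by linarith
    next
      case 3
      define b where "b = (LEAST n. n \<in> ?A)"
      from 3(1) obtain n where "n \<in> ?A" by blast
      then have bA: "b \<in> ?A" unfolding b_def by (rule LeastI)
      note lev = level[OF bA]
      have "b \<noteq> 0"
        using lev 3(2) by (cases "b = 0") auto
      then have b: "real b \<ge> 1" by simp
      have "?A \<subseteq> {b..}"
        unfolding b_def by (auto intro: Least_le)
      then have "measure ?P ?A \<le> measure ?P {b..}"
        by (intro measure_pmf.finite_measure_mono) auto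
      also have "\<dots> \<le> \<theta> ^ b / fact b"
        using poisson_tail_le assms by simp
      also have "\<dots> \<le> \<theta> ^ b / (sqrt (real b) * (real b / exp 1) ^ b)"
      proof (rule divide_left_mono)
        have "sqrt (real b) * (real b / exp 1) ^ b \<le> sqrt (real b + 1) * (real b / exp 1) ^ b"
          by (intro mult_right_mono) auto
        also have "\<dots> \<le> fact b" by (rule fact_ge_stirling)
        finally show "sqrt (real b) * (real b / exp 1) ^ b \<le> fact b" .
      qed (use assms b in auto)
      also have "\<dots> = exp \<theta> / (exp \<theta> * (real b / (\<theta> * exp 1)) ^ b * sqrt (real b))"
        using assms b by (simp add: power_divide power_mult_distrib field_simps)
      also have "\<dots> \<le> exp \<theta> / (t * sqrt (real b))"
        using lev t b assms by (intro divide_left_mono mult_right_mono mult_pos_pos) auto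
      also have "\<dots> \<le> c2 * ?B"
      proof -
        have "ln t \<le> ln (exp \<theta> * (real b / (\<theta> * exp 1)) ^ b)"
          using lev t b assms by (subst ln_le_cancel_iff) auto
        also have "\<dots> = \<theta> + real b * (ln (real b) - ln (\<theta> * exp 1))"
          using assms b by (simp add: ln_mult_pos ln_realpow ln_div)
        also have "\<dots> \<le> real b * \<theta> + real b * (ln (real b) + \<bar>ln (\<theta> * exp 1)\<bar>)"
          using assms b by (intro add_mono mult_left_mono) auto
        also have "\<dots> = real b * (D + ln (real b))"
          by (simp add: D_def algebra_simps)
        finally have main: "ln t \<le> real b * (D + ln (real b))" .
        \<comment> \<open>Since \<open>ln (ln t) \<ge> l\<close>, the constant \<open>D + 1\<close> is absorbed into \<open>K\<close>.\<close>
        have Kl: "D + 1 + ln (ln t) \<le> K * ln (ln t)"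
        proof -
          have "(D + 1) / l * l \<le> (D + 1) / l * ln (ln t)"
            using lt l D by (intro mult_left_mono) auto
          moreover have "(D + 1) / l * l = D + 1"
            using l by simp
          ultimately show ?thesis
            by (simp only: K_def distrib_right mult_1)
        qed
        \<comment> \<open>For \<open>b \<le> ln t\<close> the term \<open>ln b\<close> is at most \<open>ln (ln t)\<close>; for \<open>b > ln t\<close> the claim is clear.\<close>
        have "ln t \<le> real b * (D + 1 + ln (ln t))"
        proof (cases "real b \<le> ln t")
          case True
          then have "ln (real b) \<le> 1 + ln (ln t)"
            using b by (simp add: add_increasing)
          then have "real b * (D + ln (real b)) \<le> real b * (D + 1 + ln (ln t))"
            using b by (intro mult_left_mono) auto
          with main show ?thesis by linarith
        next
          case False
          have "real b * 1 \<le> real b * (D + 1 + ln (ln t))"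
            using b D lt l by (intro mult_left_mono) auto
          with False show ?thesis by linarith
        qed
        also have "\<dots> \<le> real b * (K * ln (ln t))"
          using Kl b by (intro mult_left_mono) auto
        finally have "sqrt (ln t) \<le> sqrt (real b * (K * ln (ln t)))"
          by simp
        then have "sqrt (ln t) \<le> sqrt K * sqrt (ln (ln t)) * sqrt (real b)"
          by (simp add: real_sqrt_mult mult_ac)
        then have "1 / sqrt (real b) \<le> sqrt K * sqrt (ln (ln t)) / sqrt (ln t)"
          using b lnt by (simp add: field_simps)
        then have "exp \<theta> / t * (1 / sqrt (real b)) \<le> exp \<theta> / t * (sqrt K * sqrt (ln (ln t)) / sqrt (ln t))"
          using t by (intro mult_left_mono) auto
        then show ?thesis
          by (simp add: c2_def mult_ac)
      qed
      also have "\<dots> \<le> (c1 + c2) * ?B"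
        using B c by (intro mult_right_mono) auto
      finally show ?thesis .
    qed
  qed
qed

end
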